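(* Let $G$ be a group, let $X$ be a (right) $G$-set with $G\cap X=\emptyset$, and let $0$ be a symbol with $0\notin G\cup X$. Then the $G$-set $X$ is transitive and congruence permutable if and only if the semigroup $S=(G,X,0)$ is congruence permutable.
   Context: Let $G$ be a group with identity $e$. A $G$-set is a right $G$-set: a non-empty set $X$ together with a map $X\times G\to X$, $(x,g)\mapsto x^g$, satisfying $x^e=x$ and $(x^g)^h=x^{(gh)}$ for all $x\in X$, $g,h\in G$. A $G$-set $X$ is transitive if for all $x,y\in X$ there is $g\in G$ with $x^g=y$. A congruence of a $G$-set $X$ is an equivalence relation $\sigma$ on $X$ such that $(a,b)\in\sigma$ implies $(a^g,b^g)\in\sigma$ for every $g\in G$. A congruence on a semigroup $(S,* )$ is an equivalence relation $\alpha$ on $S$ such that $(a,b)\in\alpha$ implies $(s*a,s*b)\in\alpha$ and $(a*s,b*s)\in\alpha$ for every $s\in S$. An algebraic structure (a $G$-set or a semigroup) is congruence permutable if $\alpha\circ\beta=\beta\circ\alpha$ for all its congruences $\alpha,\beta$, where $\circ$ is the usual composition of binary relations. The semigroup $(G,X,0)$: for a right $G$-set $X$ with $G\cap X=\emptyset$ and a symbol $0\notin G\cup X$, it is the set $S=G\cup X\cup\{0\}$ with the operation $*$ defined by: $g*h=gh$ (product in $G$) for $g,h\in G$; $x*g=x^g$ for $x\in X$, $g\in G$; $0*g=0$ for $g\in G$; and $s*a=0$ for all $s\in S$ and all $a\in X\cup\{0\}$. This is a semigroup with zero element $0$. *)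

theory Defs
  imports "HOL-Algebra.Group"
begin

text \<open>The locale \<open>group_action\<close> of HOL-Algebra is about left actions, given by homomorphisms into
  the group of bijections; here actions are on the right and the underlying set is non-empty.\<close>

locale right_G_set = group G for G (structure) +
  fixes X :: "'x set" and act :: "'x \<Rightarrow> 'a \<Rightarrow> 'x"
  assumes nonempty: "X \<noteq> {}"
    and act_closed: "\<lbrakk>x \<in> X; g \<in> carrier G\<rbrakk> \<Longrightarrow> act x g \<in> X"
    and act_one: "x \<in> X \<Longrightarrow> act x \<one> = x"
    and act_act: "\<lbrakk>x \<in> X; g \<in> carrier G; h \<in> carrier G\<rbrakk> \<Longrightarrow> act (act x g) h = act x (g \<otimes> h)"

definition transitive_G_set :: "('a, 'm) monoid_scheme \<Rightarrow> 'x set \<Rightarrow> ('x \<Rightarrow> 'a \<Rightarrow> 'x) \<Rightarrow> bool" where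
  "transitive_G_set G X act \<longleftrightarrow> (\<forall>x\<in>X. \<forall>y\<in>X. \<exists>g\<in>carrier G. act x g = y)"

definition G_set_congruence ::
  "('a, 'm) monoid_scheme \<Rightarrow> 'x set \<Rightarrow> ('x \<Rightarrow> 'a \<Rightarrow> 'x) \<Rightarrow> ('x \<times> 'x) set \<Rightarrow> bool" where
  "G_set_congruence G X act \<sigma> \<longleftrightarrow>
     equiv X \<sigma> \<and> (\<forall>(a, b)\<in>\<sigma>. \<forall>g\<in>carrier G. (act a g, act b g) \<in> \<sigma>)"

definition G_set_congruence_permutable ::
  "('a, 'm) monoid_scheme \<Rightarrow> 'x set \<Rightarrow> ('x \<Rightarrow> 'a \<Rightarrow> 'x) \<Rightarrow> bool" where
  "G_set_congruence_permutable G X act \<longleftrightarrow>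
     (\<forall>\<alpha> \<beta>. G_set_congruence G X act \<alpha> \<longrightarrow> G_set_congruence G X act \<beta> \<longrightarrow> \<alpha> O \<beta> = \<beta> O \<alpha>)"

definition semigroup_on :: "'s set \<Rightarrow> ('s \<Rightarrow> 's \<Rightarrow> 's) \<Rightarrow> bool" where
  "semigroup_on S m \<longleftrightarrow>
     (\<forall>a\<in>S. \<forall>b\<in>S. m a b \<in> S) \<and> (\<forall>a\<in>S. \<forall>b\<in>S. \<forall>c\<in>S. m (m a b) c = m a (m b c))"

definition semigroup_congruence :: "'s set \<Rightarrow> ('s \<Rightarrow> 's \<Rightarrow> 's) \<Rightarrow> ('s \<times> 's) set \<Rightarrow> bool" where
  "semigroup_congruence S m \<alpha> \<longleftrightarrow>
     equiv S \<alpha> \<and> (\<forall>(a, b)\<in>\<alpha>. \<forall>s\<in>S. (m s a, m s b) \<in> \<alpha> \<and> (m a s, m b s) \<in> \<alpha>)"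

definition semigroup_congruence_permutable :: "'s set \<Rightarrow> ('s \<Rightarrow> 's \<Rightarrow> 's) \<Rightarrow> bool" where
  "semigroup_congruence_permutable S m \<longleftrightarrow>
     (\<forall>\<alpha> \<beta>. semigroup_congruence S m \<alpha> \<longrightarrow> semigroup_congruence S m \<beta> \<longrightarrow> \<alpha> O \<beta> = \<beta> O \<alpha>)"

text \<open>The semigroup \<open>(G, X, 0)\<close>, with \<open>z\<close> for the symbol \<open>0\<close>. The sets \<open>carrier G\<close>, \<open>X\<close>
  and \<open>{z}\<close> live in one type and are meant to be pairwise disjoint, so the order of the
  cases is irrelevant. Values of the operation outside the underlying set are junk.\<close>

definition GX0_set :: "('a, 'm) monoid_scheme \<Rightarrow> 'a set \<Rightarrow> 'a \<Rightarrow> 'a set" where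
  "GX0_set G X z = carrier G \<union> X \<union> {z}"

definition GX0_mult ::
  "('a, 'm) monoid_scheme \<Rightarrow> 'a set \<Rightarrow> ('a \<Rightarrow> 'a \<Rightarrow> 'a) \<Rightarrow> 'a \<Rightarrow> 'a \<Rightarrow> 'a \<Rightarrow> 'a" where
  "GX0_mult G X act z a b =
     (if a \<in> carrier G \<and> b \<in> carrier G then a \<otimes>\<^bsub>G\<^esub> b
      else if a \<in> X \<and> b \<in> carrier G then act a b
      else z)"

lemma semigroup_on_GX0:
  fixes G (structure)
  assumes "right_G_set G X act" and "carrier G \<inter> X = {}" and "z \<notin> carrier G \<union> X"
  shows "semigroup_on (GX0_set G X z) (GX0_mult G X act z)"
proof -
  interpret right_G_set G X act by fact
  have [simp]: "z \<notin> carrier G" "z \<notin> X"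
    using assms(3) by auto
  have [simp]: "x \<notin> carrier G" if "x \<in> X" for x
    using assms(2) that by auto
  have [simp]: "act x g \<notin> carrier G" if "x \<in> X" "g \<in> carrier G" for x g
    using act_closed that by simp
  show ?thesis
    unfolding semigroup_on_def GX0_set_def GX0_mult_def
    by (simp add: ball_Un act_closed act_act m_assoc)
qed

end

theory Submission
  imports Defs
begin

text \<open>Write \<open>S = G \<union> X \<union> {0}\<close>. The congruences of \<open>S\<close> are rigid. An element of \<open>G\<close> can only be
  related to an element outside \<open>G\<close> by the universal congruence, because \<open>G\<close> acts invertibly while
  elements outside \<open>G\<close> send everything to \<open>0\<close> when they multiply from the right
  (\<open>congruence_eq_universal\<close>). If \<open>X\<close> is transitive, then moreover \<open>0\<close> can only be related to a
  point of \<open>X\<close> when all of \<open>X\<close> collapses to \<open>0\<close> (\<open>congruence_collapses\<close>). So two congruences can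
  only fail to permute inside \<open>G\<close> or inside \<open>X\<close>. In \<open>G\<close> they permute as in every group, by the
  Mal'cev term \<open>a b\<^sup>-\<^sup>1 c\<close>; in \<open>X\<close> they are congruences of the \<open>G\<close>-set and permute by hypothesis.

  Conversely, every congruence of the \<open>G\<close>-set \<open>X\<close> becomes a congruence of \<open>S\<close> by adding the
  diagonal, and compositions inside \<open>X\<close> are unchanged, so permutability passes from \<open>S\<close> to \<open>X\<close>.
  For transitivity, an orbit together with \<open>0\<close> is an ideal. The Rees congruences of the
  ideals of two distinct orbits connect points of these orbits through \<open>0\<close> in one order of
  composition, but in the other order no intermediate element is available.\<close>

section \<open>Equivalences and congruences\<close>

lemma semigroup_congruenceI:
  assumes "equiv S \<alpha>"
    and "\<And>a b s. \<lbrakk>(a, b) \<in> \<alpha>; s \<in> S\<rbrakk> \<Longrightarrow> (m s a, m s b) \<in> \<alpha>"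
    and "\<And>a b s. \<lbrakk>(a, b) \<in> \<alpha>; s \<in> S\<rbrakk> \<Longrightarrow> (m a s, m b s) \<in> \<alpha>"
  shows "semigroup_congruence S m \<alpha>"
  using assms unfolding semigroup_congruence_def by blast

lemma semigroup_congruenceD:
  assumes "semigroup_congruence S m \<alpha>"
  shows "equiv S \<alpha>"
    and "\<lbrakk>(a, b) \<in> \<alpha>; s \<in> S\<rbrakk> \<Longrightarrow> (m s a, m s b) \<in> \<alpha>"
    and "\<lbrakk>(a, b) \<in> \<alpha>; s \<in> S\<rbrakk> \<Longrightarrow> (m a s, m b s) \<in> \<alpha>"
  using assms unfolding semigroup_congruence_def by blast+

lemma equivD:
  assumes "equiv S \<alpha>"
  shows "a \<in> S \<Longrightarrow> (a, a) \<in> \<alpha>"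
    and "(a, b) \<in> \<alpha> \<Longrightarrow> (b, a) \<in> \<alpha>"
    and "\<lbrakk>(a, b) \<in> \<alpha>; (b, c) \<in> \<alpha>\<rbrakk> \<Longrightarrow> (a, c) \<in> \<alpha>"
    and "(a, b) \<in> \<alpha> \<Longrightarrow> a \<in> S" and "(a, b) \<in> \<alpha> \<Longrightarrow> b \<in> S"
proof -
  have \<alpha>: "\<alpha> \<subseteq> S \<times> S" "refl_on S \<alpha>" "sym \<alpha>" "trans \<alpha>"
    using assms by (auto elim: equivE)
  show "a \<in> S \<Longrightarrow> (a, a) \<in> \<alpha>"
    using \<alpha>(2) by (rule refl_onD)
  show "(a, b) \<in> \<alpha> \<Longrightarrow> (b, a) \<in> \<alpha>"
    using \<alpha>(3) by (rule symD)
  show "\<lbrakk>(a, b) \<in> \<alpha>; (b, c) \<in> \<alpha>\<rbrakk> \<Longrightarrow> (a, c) \<in> \<alpha>"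
    using \<alpha>(4) by (rule transD)
  show "(a, b) \<in> \<alpha> \<Longrightarrow> a \<in> S" and "(a, b) \<in> \<alpha> \<Longrightarrow> b \<in> S"
    using \<alpha>(1) by auto
qed

lemma equiv_Un_Id_on:
  assumes "equiv A \<sigma>" and "A \<subseteq> S"
  shows "equiv S (\<sigma> \<union> Id_on S)"
proof (rule equivI)
  show "\<sigma> \<union> Id_on S \<subseteq> S \<times> S"
    using equivD(4,5)[OF assms(1)] assms(2) by auto
  show "refl_on S (\<sigma> \<union> Id_on S)"
    by (auto simp: refl_on_def)
  show "sym (\<sigma> \<union> Id_on S)"
    using equivD(2)[OF assms(1)] by (auto simp: sym_def)
  show "trans (\<sigma> \<union> Id_on S)"
    using equivD(3)[OF assms(1)] by (auto simp: trans_def)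
qed

section \<open>The semigroup of a right \<open>G\<close>-set\<close>

context right_G_set
begin

lemma act_inv:
  assumes "x \<in> X" and "g \<in> carrier G"
  shows "act (act x g) (inv g) = x" and "act (act x (inv g)) g = x"
  using assms by (simp_all add: act_act act_one)

lemma transitive_if_related:
  assumes "\<And>x y. \<lbrakk>x \<in> X; y \<in> X\<rbrakk> \<Longrightarrow>
      (\<exists>g\<in>carrier G. act x g = y) \<or> (\<exists>g\<in>carrier G. act y g = x)"
  shows "transitive_G_set G X act"
  unfolding transitive_G_set_def by (metis assms act_inv(1) inv_closed)

end

locale G_set_with_zero = right_G_set G X act
  for G :: "('a, 'm) monoid_scheme" (structure) and X :: "'a set" and act +
  fixes z :: 'a
  assumes disjoint: "carrier G \<inter> X = {}" and z_fresh: "z \<notin> carrier G \<union> X"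
begin

abbreviation S :: "'a set" where "S \<equiv> GX0_set G X z"

abbreviation mult :: "'a \<Rightarrow> 'a \<Rightarrow> 'a" (infixl "\<star>" 70) where
  "a \<star> b \<equiv> GX0_mult G X act z a b"

lemma S_cases:
  assumes "s \<in> S"
  obtains "s \<in> carrier G" | "s \<in> X" | "s = z"
  using assms by (auto simp: GX0_set_def)

lemma in_S: "g \<in> carrier G \<Longrightarrow> g \<in> S" "x \<in> X \<Longrightarrow> x \<in> S" "z \<in> S"
  by (auto simp: GX0_set_def)

lemma mult_simps:
  "\<lbrakk>g \<in> carrier G; h \<in> carrier G\<rbrakk> \<Longrightarrow> g \<star> h = g \<otimes> h"
  "\<lbrakk>x \<in> X; g \<in> carrier G\<rbrakk> \<Longrightarrow> x \<star> g = act x g"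
  "z \<star> s = z"
  "s \<notin> carrier G \<Longrightarrow> t \<star> s = z"
  using disjoint z_fresh by (auto simp: GX0_mult_def)

section \<open>Congruences of the semigroup\<close>

lemma congruence_act:
  assumes "semigroup_congruence S mult \<alpha>" and "(x, y) \<in> \<alpha>" and "x \<in> X" "y \<in> X"
    and "g \<in> carrier G"
  shows "(act x g, act y g) \<in> \<alpha>"
  using semigroup_congruenceD(3)[OF assms(1,2) in_S(1)[OF assms(5)]] assms(3-5)
  by (simp add: mult_simps)

text \<open>Multiply \<open>(g, a)\<close> from the left: \<open>a\<close> always gives \<open>0\<close>, while every \<open>h \<in> G\<close> is \<open>(h g\<^sup>-\<^sup>1) g\<close> and
  every \<open>x \<in> X\<close> is the image of \<open>x\<^bsup>g\<^sup>-\<^sup>1\<^esup>\<close> under \<open>g\<close>.\<close>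

lemma congruence_eq_universal:
  assumes \<alpha>: "semigroup_congruence S mult \<alpha>"
    and ga: "(g, a) \<in> \<alpha>" and g: "g \<in> carrier G" and a: "a \<notin> carrier G"
  shows "\<alpha> = S \<times> S"
proof -
  note eq = equivD[OF semigroup_congruenceD(1)[OF \<alpha>]]
  have to_z: "(t \<star> g, z) \<in> \<alpha>" if "t \<in> S" for t
    using semigroup_congruenceD(2)[OF \<alpha> ga that] a by (simp add: mult_simps)
  have z: "(s, z) \<in> \<alpha>" if "s \<in> S" for s
    using that
  proof (cases rule: S_cases)
    case 1
    then show ?thesis
      using to_z[of "s \<otimes> inv g"] g by (simp add: in_S mult_simps m_assoc)
  next
    case 2
    then show ?thesis
      using to_z[of "act s (inv g)"] g by (simp add: in_S mult_simps act_closed act_inv)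
  next
    case 3
    then show ?thesis
      using eq(1) in_S(3) by simp
  qed
  have "\<alpha> \<subseteq> S \<times> S"
    using eq(4,5) by auto
  moreover have "(s, t) \<in> \<alpha>" if "s \<in> S" "t \<in> S" for s t
    using z[OF that(1)] eq(2)[OF z[OF that(2)]] by (rule eq(3))
  ultimately show ?thesis
    by blast
qed

lemma congruence_collapses:
  assumes trans: "transitive_G_set G X act"
    and \<alpha>: "semigroup_congruence S mult \<alpha>"
    and xz: "(x, z) \<in> \<alpha>" and x: "x \<in> X"
    and ab: "a \<in> X \<union> {z}" "b \<in> X \<union> {z}"
  shows "(a, b) \<in> \<alpha>"
proof -
  note eq = equivD[OF semigroup_congruenceD(1)[OF \<alpha>]]
  have "(y, z) \<in> \<alpha>" if y: "y \<in> X" for y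
  proof -
    obtain g where g: "g \<in> carrier G" "act x g = y"
      using trans x y unfolding transitive_G_set_def by blast
    show ?thesis
      using semigroup_congruenceD(3)[OF \<alpha> xz, of g] g x by (simp add: in_S mult_simps)
  qed
  then have z: "(y, z) \<in> \<alpha>" if "y \<in> X \<union> {z}" for y
    using that eq(1)[OF in_S(3)] by blast
  show ?thesis
    using z[OF ab(1)] eq(2)[OF z[OF ab(2)]] by (rule eq(3))
qed

section \<open>Permutability of the semigroup\<close>

text \<open>The Mal'cev argument for groups: \<open>a = a b\<^sup>-\<^sup>1 b\<close> is \<open>\<beta>\<close>-related to \<open>a b\<^sup>-\<^sup>1 c\<close>, which is
  \<open>\<alpha>\<close>-related to \<open>b b\<^sup>-\<^sup>1 c = c\<close>.\<close>

lemma congruences_permute_on_group: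
  assumes \<alpha>: "semigroup_congruence S mult \<alpha>" and \<beta>: "semigroup_congruence S mult \<beta>"
    and ab: "(a, b) \<in> \<alpha>" and bc: "(b, c) \<in> \<beta>"
    and G: "a \<in> carrier G" "b \<in> carrier G" "c \<in> carrier G"
  shows "(a, c) \<in> \<beta> O \<alpha>"
proof
  show "(a, a \<otimes> (inv b \<otimes> c)) \<in> \<beta>"
    using semigroup_congruenceD(2)[OF \<beta> bc, of "a \<otimes> inv b"] G
    by (simp add: in_S mult_simps m_assoc)
  have "b \<otimes> (inv b \<otimes> c) = c"
    using G by (simp flip: m_assoc)
  then show "(a \<otimes> (inv b \<otimes> c), c) \<in> \<alpha>"
    using semigroup_congruenceD(3)[OF \<alpha> ab, of "inv b \<otimes> c"] G
    by (simp add: in_S mult_simps)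
qed

lemma G_set_congruence_restrict:
  assumes \<alpha>: "semigroup_congruence S mult \<alpha>"
  shows "G_set_congruence G X act (\<alpha> \<inter> X \<times> X)"
proof -
  note eq = equivD[OF semigroup_congruenceD(1)[OF \<alpha>]]
  have "equiv X (\<alpha> \<inter> X \<times> X)"
  proof (rule equivI)
    show "refl_on X (\<alpha> \<inter> X \<times> X)"
      using eq(1) in_S(2) by (simp add: refl_on_def)
    show "sym (\<alpha> \<inter> X \<times> X)"
      using eq(2) by (auto simp: sym_def)
    show "trans (\<alpha> \<inter> X \<times> X)"
      using eq(3) by (auto simp: trans_def)
  qed simp
  then show ?thesis
    unfolding G_set_congruence_def using congruence_act[OF \<alpha>] act_closed by blast
qed

lemma congruences_permute_subset:
  assumes trans: "transitive_G_set G X act"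
    and perm: "G_set_congruence_permutable G X act"
    and \<alpha>: "semigroup_congruence S mult \<alpha>" and \<beta>: "semigroup_congruence S mult \<beta>"
  shows "\<alpha> O \<beta> \<subseteq> \<beta> O \<alpha>"
proof
  note eq_\<alpha> = equivD[OF semigroup_congruenceD(1)[OF \<alpha>]]
    and eq_\<beta> = equivD[OF semigroup_congruenceD(1)[OF \<beta>]]
  fix p assume "p \<in> \<alpha> O \<beta>"
  then obtain a b c where p: "p = (a, c)" and ab: "(a, b) \<in> \<alpha>" and bc: "(b, c) \<in> \<beta>"
    by auto
  have S: "a \<in> S" "b \<in> S" "c \<in> S"
    using eq_\<alpha>(4,5)[OF ab] eq_\<beta>(5)[OF bc] by auto
  show "p \<in> \<beta> O \<alpha>"
    \<comment> \<open>If \<open>a\<close> and \<open>c\<close> are related by one congruence, an end point serves as intermediate element.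
      This disposes of universal congruences and, for \<open>a\<close> and \<open>c\<close> outside \<open>G\<close>, of those that
      collapse \<open>X \<union> {0}\<close>.\<close>
  proof (cases "(a, c) \<in> \<alpha> \<or> (a, c) \<in> \<beta>")
    case True
    then show ?thesis
      using p eq_\<alpha>(1) eq_\<beta>(1) S by blast
  next
    case False
    \<comment> \<open>Neither congruence is universal, so \<open>a\<close>, \<open>b\<close>, \<open>c\<close> all lie in \<open>G\<close> or all outside it.\<close>
    have "a \<in> carrier G \<longleftrightarrow> b \<in> carrier G"
      using congruence_eq_universal[OF \<alpha>] ab eq_\<alpha>(2) False S by blast
    moreover have "b \<in> carrier G \<longleftrightarrow> c \<in> carrier G"
      using congruence_eq_universal[OF \<beta>] bc eq_\<beta>(2) False S by blast
    ultimately consider (group) "a \<in> carrier G" "b \<in> carrier G" "c \<in> carrier G"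
      | (set) "a \<in> X \<union> {z}" "b \<in> X \<union> {z}" "c \<in> X \<union> {z}"
      using S by (auto simp: GX0_set_def)
    then show ?thesis
    proof cases
      case group
      then show ?thesis
        using congruences_permute_on_group[OF \<alpha> \<beta> ab bc] p by simp
    next
      case set
      \<comment> \<open>Neither congruence collapses \<open>X \<union> {0}\<close>, so \<open>a\<close>, \<open>b\<close>, \<open>c\<close> are all \<open>0\<close> or all in \<open>X\<close>.\<close>
      have \<alpha>_z: "(x, z) \<notin> \<alpha>" if "x \<in> X" for x
        using congruence_collapses[OF trans \<alpha> _ that set(1,3)] False by blast
      have \<beta>_z: "(x, z) \<notin> \<beta>" if "x \<in> X" for x
        using congruence_collapses[OF trans \<beta> _ that set(1,3)] False by blast
      have "a = z \<longleftrightarrow> b = z"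
        using \<alpha>_z ab eq_\<alpha>(2) set by blast
      moreover have "b = z \<longleftrightarrow> c = z"
        using \<beta>_z bc eq_\<beta>(2) set by blast
      moreover have "\<not> (a = z \<and> c = z)"
        using False eq_\<alpha>(1) S by blast
      ultimately have "a \<in> X" "b \<in> X" "c \<in> X"
        using set by auto
      then have "(a, c) \<in> (\<alpha> \<inter> X \<times> X) O (\<beta> \<inter> X \<times> X)"
        using ab bc by blast
      also have "\<dots> = (\<beta> \<inter> X \<times> X) O (\<alpha> \<inter> X \<times> X)"
        using perm G_set_congruence_restrict[OF \<alpha>] G_set_congruence_restrict[OF \<beta>]
        unfolding G_set_congruence_permutable_def by blast
      finally show ?thesis
        using p by blast
    qed
  qed
qed

section \<open>Extending congruences from the \<open>G\<close>-set\<close>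

text \<open>The common source of both kinds of congruences used for the converse: extensions of
  congruences of \<open>X\<close> (with \<open>A = X\<close>) and Rees congruences (with \<open>\<sigma> = A \<times> A\<close>). Left multiplication
  is harmless because it maps all of \<open>X \<union> {0}\<close> to \<open>0\<close>.\<close>

lemma semigroup_congruence_Un_Id_on:
  assumes \<sigma>: "equiv A \<sigma>" and A: "A \<subseteq> X \<union> {z}"
    and right: "\<And>a b g. \<lbrakk>(a, b) \<in> \<sigma>; g \<in> carrier G\<rbrakk> \<Longrightarrow> (a \<star> g, b \<star> g) \<in> \<sigma> \<union> Id_on S"
  shows "semigroup_congruence S mult (\<sigma> \<union> Id_on S)"
proof (rule semigroup_congruenceI)
  show "equiv S (\<sigma> \<union> Id_on S)"
    using \<sigma> A by (intro equiv_Un_Id_on) (auto simp: GX0_set_def)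
next
  have closed: "s \<star> t \<in> S" if "s \<in> S" "t \<in> S" for s t
    using semigroup_on_GX0[OF right_G_set_axioms disjoint z_fresh] that
    unfolding semigroup_on_def by blast
  fix a b s assume ab: "(a, b) \<in> \<sigma> \<union> Id_on S" and s: "s \<in> S"
  have outside: "a \<notin> carrier G" "b \<notin> carrier G" if "(a, b) \<in> \<sigma>"
    using equivD(4,5)[OF \<sigma> that] A disjoint z_fresh by auto
  show "(s \<star> a, s \<star> b) \<in> \<sigma> \<union> Id_on S"
    using ab s closed outside in_S(3) by (auto simp: mult_simps)
  show "(a \<star> s, b \<star> s) \<in> \<sigma> \<union> Id_on S"
  proof (cases "(a, b) \<in> \<sigma> \<and> s \<in> carrier G")
    case True
    then show ?thesis
      using right by blast
  next
    case False
    then have "a \<star> s = b \<star> s"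
      using ab by (auto simp: mult_simps)
    moreover have "b \<in> S"
      using ab equivD(5)[OF \<sigma>] A by (auto simp: GX0_set_def)
    ultimately show ?thesis
      using s closed by auto
  qed
qed

lemma G_set_congruence_extends:
  assumes "G_set_congruence G X act \<sigma>"
  shows "semigroup_congruence S mult (\<sigma> \<union> Id_on S)"
proof (rule semigroup_congruence_Un_Id_on)
  show \<sigma>: "equiv X \<sigma>"
    using assms by (simp add: G_set_congruence_def)
  fix a b g assume "(a, b) \<in> \<sigma>" "g \<in> carrier G"
  then show "(a \<star> g, b \<star> g) \<in> \<sigma> \<union> Id_on S"
    using assms equivD(4,5)[OF \<sigma>] by (auto simp: G_set_congruence_def mult_simps)
qed auto

lemma Rees_congruence_orbit:
  assumes x: "x \<in> X" and A: "A = insert z {act x g |g. g \<in> carrier G}"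
  shows "semigroup_congruence S mult (A \<times> A \<union> Id_on S)"
proof (rule semigroup_congruence_Un_Id_on)
  show "equiv A (A \<times> A)"
    by (auto simp: equiv_def refl_on_def sym_def trans_def)
  show "A \<subseteq> X \<union> {z}"
    using A x act_closed by auto
  have "a \<star> g \<in> A" if "a \<in> A" "g \<in> carrier G" for a g
    using that A x by (auto simp: mult_simps act_closed act_act)
  then show "(a \<star> g, b \<star> g) \<in> A \<times> A \<union> Id_on S" if "(a, b) \<in> A \<times> A" "g \<in> carrier G" for a b g
    using that by blast
qed

lemma G_set_congruence_permutable_if_semigroup:
  assumes perm: "semigroup_congruence_permutable S mult"
  shows "G_set_congruence_permutable G X act"
proof -
  have compose_inside: "(\<sigma> \<union> Id_on S) O (\<tau> \<union> Id_on S) \<inter> X \<times> X = \<sigma> O \<tau>"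
    if "equiv X \<sigma>" "equiv X \<tau>" for \<sigma> \<tau>
  proof -
    have "\<sigma> O \<tau> \<subseteq> X \<times> X"
      using equivD(4)[OF that(1)] equivD(5)[OF that(2)] by auto
    moreover have "\<sigma> \<inter> X \<times> X \<subseteq> \<sigma> O \<tau>" "\<tau> \<inter> X \<times> X \<subseteq> \<sigma> O \<tau>" "Id_on X \<subseteq> \<sigma> O \<tau>"
      using equivD(1)[OF that(1)] equivD(1)[OF that(2)] by auto
    ultimately show ?thesis
      by auto
  qed
  show ?thesis
    unfolding G_set_congruence_permutable_def
  proof (intro allI impI)
    fix \<sigma> \<tau>
    assume \<sigma>: "G_set_congruence G X act \<sigma>" and \<tau>: "G_set_congruence G X act \<tau>"
    then have "(\<sigma> \<union> Id_on S) O (\<tau> \<union> Id_on S) = (\<tau> \<union> Id_on S) O (\<sigma> \<union> Id_on S)"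
      using perm G_set_congruence_extends unfolding semigroup_congruence_permutable_def by blast
    then show "\<sigma> O \<tau> = \<tau> O \<sigma>"
      using compose_inside \<sigma> \<tau> unfolding G_set_congruence_def by metis
  qed
qed

lemma transitive_if_semigroup_permutable:
  assumes perm: "semigroup_congruence_permutable S mult"
  shows "transitive_G_set G X act"
proof (rule transitive_if_related)
  fix x y assume x: "x \<in> X" and y: "y \<in> X"
  define A where "A = insert z {act x g |g. g \<in> carrier G}"
  define B where "B = insert z {act y g |g. g \<in> carrier G}"
  have in_A: "x \<in> A" "z \<in> A" and in_B: "y \<in> B" "z \<in> B"
    unfolding A_def B_def using act_one[OF x] act_one[OF y] by force+
  have "(x, y) \<in> (A \<times> A \<union> Id_on S) O (B \<times> B \<union> Id_on S)"
    using in_A in_B by blast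
  also have "\<dots> = (B \<times> B \<union> Id_on S) O (A \<times> A \<union> Id_on S)"
    using perm Rees_congruence_orbit[OF x A_def] Rees_congruence_orbit[OF y B_def]
    unfolding semigroup_congruence_permutable_def by blast
  finally obtain d where "(x, d) \<in> B \<times> B \<union> Id_on S" "(d, y) \<in> A \<times> A \<union> Id_on S"
    by blast
  \<comment> \<open>If \<open>x \<notin> B\<close>, the first pair forces \<open>d = x\<close>, and the second gives \<open>y = x\<close> or \<open>y \<in> A\<close>.\<close>
  then have "y \<in> A \<or> x \<in> B"
    using in_A by auto
  moreover have "x \<noteq> z" "y \<noteq> z"
    using x y z_fresh by auto
  ultimately show "(\<exists>g\<in>carrier G. act x g = y) \<or> (\<exists>g\<in>carrier G. act y g = x)"
    unfolding A_def B_def by auto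
qed

end

section \<open>The equivalence\<close>

theorem theorem1:
  fixes G :: "('a, 'm) monoid_scheme" and X :: "'a set" and act :: "'a \<Rightarrow> 'a \<Rightarrow> 'a" and z :: 'a
  assumes "group G"
    and "right_G_set G X act"
    and "carrier G \<inter> X = {}"
    and "z \<notin> carrier G \<union> X"
  shows "(transitive_G_set G X act \<and> G_set_congruence_permutable G X act) \<longleftrightarrow>
         semigroup_congruence_permutable (GX0_set G X z) (GX0_mult G X act z)"
proof -
  interpret G_set_with_zero G X act z
    using assms by (intro G_set_with_zero.intro G_set_with_zero_axioms.intro)
  show ?thesis
  proof (intro iffI conjI)
    assume "transitive_G_set G X act \<and> G_set_congruence_permutable G X act"
    then show "semigroup_congruence_permutable S mult"
      unfolding semigroup_congruence_permutable_def
      using congruences_permute_subset by (simp add: subset_antisym)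
  qed (fact transitive_if_semigroup_permutable G_set_congruence_permutable_if_semigroup)+
qed

end
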